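(* Suppose $\ell_\phi(y,\mathbf{f}(x)):[K+1]\times\mathbb{R}^{K+1}\to\mathbb{R}$ is a consistent surrogate for multi-class classification with $K+1$ classes, meaning that if $\mathbf{f}^*=\mathrm{arginf}_{\mathbf{f}}\,\mathbb{E}[\ell_\phi(Y,\mathbf{f}(X))]$ over all functions $\mathbf{f}:\mathcal{X}\to\mathbb{R}^{K+1}$, then $\tilde h_{\mathbf{f}^*}=\mathrm{arginf}_{h}\,\mathbb{E}[\mathbb{I}_{Y\neq h(X)}]$ (over all functions $h:\mathcal{X}\to[K+1]$). Then the surrogate $$\tilde\ell_\phi(\mathbf{c},\mathbf{f}(x))=\sum_{i=1}^{K+1}\Big[\max_{j\in[K+1]}c(j)-c(i)\Big]\ell_\phi(i,\mathbf{f}(x))$$ is a consistent surrogate for cost-sensitive learning (a minimizer $\tilde{\mathbf{f}}^*$ of $\mathbb{E}[\tilde\ell_\phi(\mathbf{c},\mathbf{f}(X))]$ over all functions $\mathbf{f}$ yields $\tilde h_{\tilde{\mathbf{f}}^*}$ minimizing $\mathbb{E}[c(\tilde h(X))]$ over all $\tilde h:\mathcal{X}\to[K+1]$), and thus for learning to defer: with the costs $\mathbf{c}$ of the learning-to-defer reduction, if $\tilde{\mathbf{f}}^*=\mathrm{arginf}_{\mathbf{f}}\,\mathbb{E}[\tilde\ell_\phi(\mathbf{c},\mathbf{f}(X))]$, then the classifier-rejector pair $(h_{\tilde{\mathbf{f}}^*},r_{\tilde{\mathbf{f}}^*})$ decoded from $\tilde h_{\tilde{\mathbf{f}}^*}$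 satisfies $$(h_{\tilde{\mathbf{f}}^*},r_{\tilde{\mathbf{f}}^*})=\mathrm{arginf}_{h,r}\,L_{\mathrm{def}}^{0-1}(h,r).$$
   Context: Setting: features $X\in\mathcal{X}$, label $Y\in[K]=\{1,\dots,K\}$, expert prediction $M$, with joint law $\mu_{XYM}$; classifier $h:\mathcal{X}\to[K]$, rejector $r:\mathcal{X}\to\{0,1\}$ ($r(x)=1$ means defer). The deferral loss is $L_{\mathrm{def}}^{0-1}(h,r)=\mathbb{E}[\mathbb{I}_{h(X)\neq Y}\mathbb{I}_{r(X)=0}+\mathbb{I}_{M\neq Y}\mathbb{I}_{r(X)=1}]$; $\mathrm{arginf}_{h,r}$ is over all functions. Cost-sensitive learning: given a random cost vector $\mathbf{c}\in\mathbb{R}_+^{K+1}$ with components $c(i)$, jointly distributed with $X$, one seeks $\tilde h:\mathcal{X}\to[K+1]$ minimizing $\mathbb{E}[c(\tilde h(X))]$. Reduction of learning to defer (0-1 loss): $c(i)=\mathbb{I}_{i\neq Y}$ for $i\in[K]$ and $c(K+1)=\mathbb{I}_{M\neq Y}$. For $\mathbf{f}=(f_1,\dots,f_{K+1})$ with $f_i:\mathcal{X}\to\mathbb{R}$, set $\tilde h_{\mathbf{f}}(x)=\arg\max_{i\in[K+1]}f_i(x)$. The decoded pair $(h_{\mathbf{f}},r_{\mathbf{f}})$ is: $h_{\mathbf{f}}(x)=i,\ r_{\mathbf{f}}(x)=0$ if $\tilde h_{\mathbf{f}}(x)=i\in[K]$; and $h_{\mathbf{f}}(x)=1$ (dummy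 value), $r_{\mathbf{f}}(x)=1$ if $\tilde h_{\mathbf{f}}(x)=K+1$. The consistency hypothesis on $\ell_\phi$ is for every distribution of $(X,Y)$ on $\mathcal{X}\times[K+1]$.
   Formalization: The random costs c(i) are assumed to have finite expectation; for costs of infinite mean the cost-sensitive claim can fail (e.g. a hinge surrogate shifted by a negative constant). The learning-to-defer part is unaffected, since its costs are 0/1. *)

theory Defs
  imports "HOL-Probability.Probability"
begin

text \<open>
  A feature space is the measurable space underlying a measure \<open>S\<close>; only its \<open>\<sigma>\<close>-algebra is used.
  A joint law is a probability measure on a product with \<open>S\<close>. ``All functions'' on \<open>S\<close> means
  all measurable ones, as otherwise their risks are undefined.
\<close>

text \<open>
  Euclidean space with coordinates indexed by \<open>{1..K+1}\<close>, used both for scores and for costs.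
\<close>

definition vec_space :: "nat \<Rightarrow> (nat \<Rightarrow> real) measure" where
  "vec_space K = Pi\<^sub>M {1..K+1} (\<lambda>_. borel)"

text \<open>
  The maximizer of a score vector need not be unique. An argmax rule picks one maximizer for each
  vector, with ties broken in an arbitrary but fixed, measurable way.
\<close>

definition argmax_rule :: "nat \<Rightarrow> ((nat \<Rightarrow> real) \<Rightarrow> nat) \<Rightarrow> bool" where
  "argmax_rule K am \<longleftrightarrow>
     am \<in> vec_space K \<rightarrow>\<^sub>M count_space {1..K+1} \<and>
     (\<forall>v \<in> space (vec_space K). is_arg_max v (\<lambda>i. i \<in> {1..K+1}) (am v))"

text \<open>
  The Bochner integral of a non-integrable function is \<open>0\<close>, so surrogate risks are compared only
  between score functions with finite risk. Competitors of risk \<open>\<infinity>\<close> are irrelevant to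
  minimality. If the laws give the constant score functions finite risk, as is the case for all laws
  considered below, and some score function has risk \<open>-\<infinity>\<close>, then making it constant
  wherever its loss is large yields integrable competitors of arbitrarily low risk, so that no
  minimizer in the sense below exists.
\<close>

definition surrogate_minimizer ::
  "'x measure \<Rightarrow> nat \<Rightarrow> ('x \<times> 'a) measure \<Rightarrow> ('a \<Rightarrow> (nat \<Rightarrow> real) \<Rightarrow> real) \<Rightarrow>
   ('x \<Rightarrow> nat \<Rightarrow> real) \<Rightarrow> bool" where
  "surrogate_minimizer S K D loss f \<longleftrightarrow>
     is_arg_min (\<lambda>f. \<integral>(x, a). loss a (f x) \<partial>D)
       (\<lambda>f. f \<in> S \<rightarrow>\<^sub>M vec_space K \<and> integrable D (\<lambda>(x, a). loss a (f x))) f"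

definition multiclass_consistent ::
  "'x measure \<Rightarrow> nat \<Rightarrow> ((nat \<Rightarrow> real) \<Rightarrow> nat) \<Rightarrow> (nat \<Rightarrow> (nat \<Rightarrow> real) \<Rightarrow> real) \<Rightarrow> bool" where
  "multiclass_consistent S K am loss \<longleftrightarrow>
     (\<forall>D f. prob_space D \<longrightarrow> sets D = sets (S \<Otimes>\<^sub>M count_space {1..K+1}) \<longrightarrow>
        surrogate_minimizer S K D loss f \<longrightarrow>
        is_arg_min (\<lambda>h. \<integral>(x, y). of_bool (y \<noteq> h x) \<partial>D :: real)
          (\<lambda>h. h \<in> S \<rightarrow>\<^sub>M count_space {1..K+1}) (\<lambda>x. am (f x)))"

definition cs_surrogate ::
  "nat \<Rightarrow> (nat \<Rightarrow> (nat \<Rightarrow> real) \<Rightarrow> real) \<Rightarrow> (nat \<Rightarrow> real) \<Rightarrow> (nat \<Rightarrow> real) \<Rightarrow> real" where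
  "cs_surrogate K loss c v =
     (\<Sum>i\<in>{1..K+1}. (Max (c ` {1..K+1}) - c i) * loss i v)"

text \<open>
  Joint laws of the features and a nonnegative cost vector with finite expectation.
\<close>

definition cost_law :: "'x measure \<Rightarrow> nat \<Rightarrow> ('x \<times> (nat \<Rightarrow> real)) measure \<Rightarrow> bool" where
  "cost_law S K D \<longleftrightarrow>
     prob_space D \<and> sets D = sets (S \<Otimes>\<^sub>M vec_space K) \<and>
     (AE (x, c) in D. \<forall>i\<in>{1..K+1}. 0 \<le> c i) \<and>
     (\<forall>i\<in>{1..K+1}. integrable D (\<lambda>(x, c). c i))"

definition cost_sensitive_consistent ::
  "'x measure \<Rightarrow> nat \<Rightarrow> ((nat \<Rightarrow> real) \<Rightarrow> nat) \<Rightarrow> ((nat \<Rightarrow> real) \<Rightarrow> (nat \<Rightarrow> real) \<Rightarrow> real) \<Rightarrow> bool" where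
  "cost_sensitive_consistent S K am loss \<longleftrightarrow>
     (\<forall>D f. cost_law S K D \<longrightarrow> surrogate_minimizer S K D loss f \<longrightarrow>
        is_arg_min (\<lambda>h. \<integral>(x, c). c (h x) \<partial>D)
          (\<lambda>h. h \<in> S \<rightarrow>\<^sub>M count_space {1..K+1}) (\<lambda>x. am (f x)))"

definition deferral_loss ::
  "('x \<times> nat \<times> nat) measure \<Rightarrow> ('x \<Rightarrow> nat) \<Rightarrow> ('x \<Rightarrow> nat) \<Rightarrow> real" where
  "deferral_loss \<mu> h r =
     (\<integral>(x, y, m). of_bool (h x \<noteq> y) * of_bool (r x = 0) +
                  of_bool (m \<noteq> y) * of_bool (r x = 1) \<partial>\<mu>)"

definition deferral_cost :: "nat \<Rightarrow> nat \<Rightarrow> nat \<Rightarrow> nat \<Rightarrow> real" where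
  "deferral_cost K y m =
     (\<lambda>i\<in>{1..K+1}. if i = K + 1 then of_bool (m \<noteq> y) else of_bool (i \<noteq> y))"

definition decode_classifier :: "nat \<Rightarrow> nat \<Rightarrow> nat" where
  "decode_classifier K i = (if i = K + 1 then 1 else i)"

definition decode_rejector :: "nat \<Rightarrow> nat \<Rightarrow> nat" where
  "decode_rejector K i = (if i = K + 1 then 1 else 0)"

text \<open>
  Laws are over triples of features, label and expert prediction. The expert prediction is not
  required to be one of the labels \<open>{1..K}\<close>.
\<close>

definition deferral_consistent ::
  "'x measure \<Rightarrow> nat \<Rightarrow> ((nat \<Rightarrow> real) \<Rightarrow> nat) \<Rightarrow> ((nat \<Rightarrow> real) \<Rightarrow> (nat \<Rightarrow> real) \<Rightarrow> real) \<Rightarrow> bool" where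
  "deferral_consistent S K am loss \<longleftrightarrow>
     (\<forall>\<mu> f. prob_space \<mu> \<longrightarrow>
        sets \<mu> = sets (S \<Otimes>\<^sub>M count_space {1..K} \<Otimes>\<^sub>M count_space UNIV) \<longrightarrow>
        surrogate_minimizer S K \<mu> (\<lambda>(y, m). loss (deferral_cost K y m)) f \<longrightarrow>
        is_arg_min (\<lambda>(h, r). deferral_loss \<mu> h r)
          (\<lambda>(h, r). h \<in> S \<rightarrow>\<^sub>M count_space {1..K} \<and> r \<in> S \<rightarrow>\<^sub>M count_space {0, 1})
          (\<lambda>x. decode_classifier K (am (f x)), \<lambda>x. decode_rejector K (am (f x))))"

end

theory Submission imports Defs begin

text \<open>
  With weights \<open>w\<^sub>i = max c - c i\<close>, the surrogate risk is, up to normalization, the multiclass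
  risk of \<open>loss\<close> under the law that draws label \<open>i\<close> with density \<open>w\<^sub>i\<close>, and the 0-1 risk of
  \<open>h\<close> under that law is the expectation of \<open>(\<Sum>i. w\<^sub>i) - w\<^sub>h = (\<Sum>i. w\<^sub>i) - max c + c h\<close>. The obstacle is
  integrability: positive and negative parts of the individual losses may cancel in the surrogate,
  so that a cost-sensitive minimizer \<open>f\<close> has no finite risk under the label law. The law is
  therefore restricted to the features where all \<open>\<bar>loss i (f x)\<bar>\<close> are at most \<open>n\<close>; the resulting
  inequality passes to the limit \<open>n \<rightarrow> \<infinity>\<close> by dominated convergence. The deferral problem is the
  cost-sensitive problem for the image law under \<open>deferral_cost\<close>.
\<close>

section \<open>Integration over finite label sets, and construction of the label law\<close>

lemma measurable_count_space_mono:
  "f \<in> M \<rightarrow>\<^sub>M count_space A \<Longrightarrow> A \<subseteq> B \<Longrightarrow> f \<in> M \<rightarrow>\<^sub>M count_space B"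
  by (rule measurable_compose[where g = "\<lambda>x. x"]) auto

text \<open>Tonelli for the norm turns the integral into a finite sum of integrals, one per label,
  and such a sum is finite iff every summand is. Fubini then gives the value.\<close>

lemma (in sigma_finite_measure) pair_count_space_finite:
  fixes g :: "'a \<times> 'b \<Rightarrow> real"
  assumes I: "finite I" and g: "g \<in> borel_measurable (M \<Otimes>\<^sub>M count_space I)"
  shows integrable_pair_count_space_finite:
      "integrable (M \<Otimes>\<^sub>M count_space I) g \<longleftrightarrow> (\<forall>i\<in>I. integrable M (\<lambda>x. g (x, i)))"
    and integral_pair_count_space_finite:
      "integrable (M \<Otimes>\<^sub>M count_space I) g \<Longrightarrow>
        integral\<^sup>L (M \<Otimes>\<^sub>M count_space I) g = (\<Sum>i\<in>I. \<integral>x. g (x, i) \<partial>M)"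
proof -
  interpret C: sigma_finite_measure "count_space I"
    by (rule sigma_finite_measure_count_space_finite[OF I])
  interpret P: pair_sigma_finite M "count_space I" ..
  have gi: "(\<lambda>x. g (x, i)) \<in> borel_measurable M" if "i \<in> I" for i
    using that by (intro measurable_compose[OF _ g] measurable_Pair) auto
  have "(\<integral>\<^sup>+z. norm (g z) \<partial>(M \<Otimes>\<^sub>M count_space I)) = (\<integral>\<^sup>+x. \<integral>\<^sup>+i. norm (g (x, i)) \<partial>count_space I \<partial>M)"
    using g by (intro C.nn_integral_fst[symmetric]) auto
  also have "\<dots> = (\<Sum>i\<in>I. \<integral>\<^sup>+x. norm (g (x, i)) \<partial>M)"
    using gi I by (simp add: nn_integral_count_space_finite nn_integral_sum del: sum_ennreal)
  finally have norm: "(\<integral>\<^sup>+z. norm (g z) \<partial>(M \<Otimes>\<^sub>M count_space I)) =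
    (\<Sum>i\<in>I. \<integral>\<^sup>+x. norm (g (x, i)) \<partial>M)" .
  show iff: "integrable (M \<Otimes>\<^sub>M count_space I) g \<longleftrightarrow> (\<forall>i\<in>I. integrable M (\<lambda>x. g (x, i)))"
    using g gi I norm by (auto simp: integrable_iff_bounded less_top[symmetric])
  assume int: "integrable (M \<Otimes>\<^sub>M count_space I) g"
  have "integral\<^sup>L (M \<Otimes>\<^sub>M count_space I) g = (\<integral>x. \<integral>i. g (x, i) \<partial>count_space I \<partial>M)"
    using P.integral_fst'[OF int] by simp
  also have "\<dots> = (\<Sum>i\<in>I. \<integral>x. g (x, i) \<partial>M)"
    using I int iff by (simp add: lebesgue_integral_count_space_finite Bochner_Integration.integral_sum)
  finally show "integral\<^sup>L (M \<Otimes>\<^sub>M count_space I) g = (\<Sum>i\<in>I. \<integral>x. g (x, i) \<partial>M)" .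
qed

text \<open>\<open>L\<close> is the image under \<open>((x, c), i)\<close> to \<open>(x, i)\<close>
  of the measure on \<open>D\<close> times the labels whose density is \<open>w i\<close> over the
  total weight. Costs are forgotten because multiclass laws live on features and labels only.
  Integrability is stated as an equivalence since it is used both to show that a score has finite
  risk under \<open>L\<close> and to exploit that a competitor has.\<close>

lemma exists_label_law:
  fixes w :: "'b \<Rightarrow> 'x \<times> 'c \<Rightarrow> real"
  assumes "sigma_finite_measure D" and D: "sets D = sets (S \<Otimes>\<^sub>M V)" and I: "finite I"
    and w: "\<And>i. i \<in> I \<Longrightarrow> integrable D (w i)"
    and nonneg: "\<And>i z. i \<in> I \<Longrightarrow> z \<in> space D \<Longrightarrow> 0 \<le> w i z"
    and pos: "0 < (\<Sum>i\<in>I. integral\<^sup>L D (w i))"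
  obtains L where "prob_space L" "sets L = sets (S \<Otimes>\<^sub>M count_space I)"
    "\<And>g. g \<in> borel_measurable (S \<Otimes>\<^sub>M count_space I) \<Longrightarrow>
      integrable L g \<longleftrightarrow> (\<forall>i\<in>I. integrable D (\<lambda>z. w i z * g (fst z, i)))"
    "\<And>g. g \<in> borel_measurable (S \<Otimes>\<^sub>M count_space I) \<Longrightarrow> integrable L g \<Longrightarrow>
      integral\<^sup>L L g = (\<Sum>i\<in>I. \<integral>z. w i z * g (fst z, i) \<partial>D) / (\<Sum>i\<in>I. integral\<^sup>L D (w i))"
proof -
  interpret sigma_finite_measure D by fact
  define T where "T = (\<Sum>i\<in>I. integral\<^sup>L D (w i))"
  have T: "0 < T" using pos by (simp add: T_def)
  define P where "P = D \<Otimes>\<^sub>M count_space I"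
  define d where "d p = w (snd p) (fst p) / T" for p
  define \<pi> where "\<pi> p = (fst (fst p), snd p)" for p :: "('x \<times> 'c) \<times> 'b"
  define L where "L = distr (density P (\<lambda>p. ennreal (d p))) (S \<Otimes>\<^sub>M count_space I) \<pi>"
  have fstD: "fst \<in> D \<rightarrow>\<^sub>M S"
    by (subst measurable_cong_sets[OF D refl]) simp
  have \<pi>: "\<pi> \<in> P \<rightarrow>\<^sub>M S \<Otimes>\<^sub>M count_space I"
    unfolding \<pi>_def P_def using fstD by measurable
  \<comment> \<open>Each \<open>w i\<close> is measurable for its own label only; finiteness of
    \<open>I\<close> makes the weight jointly measurable.\<close>
  have "(\<lambda>p. w (snd p) (fst p)) \<in> borel_measurable P"
    unfolding P_def
    by (rule measurable_compose_countable'[where I = I])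
       (use w I in \<open>auto intro: countable_finite borel_measurable_integrable measurable_compose[OF measurable_fst]\<close>)
  then have d: "d \<in> borel_measurable P"
    unfolding d_def by measurable
  have d_nonneg: "AE p in P. 0 \<le> d p"
    using nonneg T by (intro AE_I2) (auto simp: P_def d_def space_pair_measure)
  have int_iff: "integrable L g \<longleftrightarrow> integrable P (\<lambda>p. d p * g (\<pi> p))"
    and int_eq: "integral\<^sup>L L g = integral\<^sup>L P (\<lambda>p. d p * g (\<pi> p))"
    if g: "g \<in> borel_measurable (S \<Otimes>\<^sub>M count_space I)" for g :: "'x \<times> 'b \<Rightarrow> real"
  proof -
    have g\<pi>: "(\<lambda>p. g (\<pi> p)) \<in> borel_measurable P"
      using g \<pi> by (rule measurable_compose[rotated])
    show "integrable L g \<longleftrightarrow> integrable P (\<lambda>p. d p * g (\<pi> p))"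
      unfolding L_def using g \<pi> g\<pi> d d_nonneg
      by (subst integrable_distr_eq) (auto simp: integrable_density)
    show "integral\<^sup>L L g = integral\<^sup>L P (\<lambda>p. d p * g (\<pi> p))"
      unfolding L_def using g \<pi> g\<pi> d d_nonneg
      by (subst integral_distr) (auto simp: integral_density)
  qed
  have meas: "(\<lambda>p. d p * g (\<pi> p)) \<in> borel_measurable P"
    if g: "g \<in> borel_measurable (S \<Otimes>\<^sub>M count_space I)" for g :: "'x \<times> 'b \<Rightarrow> real"
    using d measurable_compose[OF \<pi> g] by simp
  have scale: "integrable D (\<lambda>z. w i z / T * v z) \<longleftrightarrow> integrable D (\<lambda>z. w i z * v z)" for i v
    using integrable_mult_left_iff[of D "1 / T" "\<lambda>z. w i z * v z"] T by simp
  have integrable: "integrable L g \<longleftrightarrow> (\<forall>i\<in>I. integrable D (\<lambda>z. w i z * g (fst z, i)))"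
    if g: "g \<in> borel_measurable (S \<Otimes>\<^sub>M count_space I)" for g :: "'x \<times> 'b \<Rightarrow> real"
    unfolding int_iff[OF g] unfolding P_def
      integrable_pair_count_space_finite[OF I meas[OF g, unfolded P_def]]
    by (simp only: d_def \<pi>_def fst_conv snd_conv scale)
  have integral: "integral\<^sup>L L g = (\<Sum>i\<in>I. \<integral>z. w i z * g (fst z, i) \<partial>D) / T"
    if g: "g \<in> borel_measurable (S \<Otimes>\<^sub>M count_space I)" and "integrable L g"
    for g :: "'x \<times> 'b \<Rightarrow> real"
    using that(2) unfolding int_iff[OF g] int_eq[OF g] unfolding P_def
    by (subst integral_pair_count_space_finite[OF I meas[OF g, unfolded P_def]])
       (auto simp: d_def \<pi>_def sum_divide_distrib)
  \<comment> \<open>The constant \<open>1\<close> as test function yields the total mass of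
    \<open>L\<close>: the sum of the integrals of the weights, divided by itself.\<close>
  have one: "integrable L (\<lambda>_. 1 :: real)" "integral\<^sup>L L (\<lambda>_. 1 :: real) = 1"
  proof -
    show "integrable L (\<lambda>_. 1 :: real)"
      by (subst integrable) (use w in auto)
    from integral[OF _ this] T show "integral\<^sup>L L (\<lambda>_. 1 :: real) = 1"
      by (simp add: T_def)
  qed
  have "finite_measure L"
    using one(1) by (intro finite_measureI) (auto simp: integrable_iff_bounded)
  then have "prob_space L"
    using one(2) finite_measure.emeasure_eq_measure[of L "space L"] by (intro prob_spaceI) simp
  moreover have "sets L = sets (S \<Otimes>\<^sub>M count_space I)"
    by (simp add: L_def)
  ultimately show thesis
    using integrable integral by (intro that[of L]) (auto simp: T_def)
qed

section \<open>Measurability of scores, surrogates and chosen costs\<close>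

lemma measurable_vec_component:
  "i \<in> {1..K+1} \<Longrightarrow> (\<lambda>c. c i) \<in> borel_measurable (vec_space K)"
  unfolding vec_space_def by measurable

text \<open>The label selects which \<open>loss y\<close> is evaluated; the finitely many maps for
  fixed labels are glued along the label coordinate.\<close>

lemma measurable_score:
  assumes "\<And>i. i \<in> {1..K+1} \<Longrightarrow> loss i \<in> borel_measurable (vec_space K)"
    and "f \<in> S \<rightarrow>\<^sub>M vec_space K"
  shows "(\<lambda>(x, y). loss y (f x) :: real) \<in> borel_measurable (S \<Otimes>\<^sub>M count_space {1..K+1})"
  unfolding case_prod_unfold
  by (rule measurable_compose_countable'[where I = "{1..K+1}"])
     (use assms in \<open>auto intro!: measurable_compose[OF _ assms(1)] measurable_compose[OF _ assms(2)]\<close>)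

lemma measurable_cs_surrogate:
  assumes "\<And>i. i \<in> {1..K+1} \<Longrightarrow> loss i \<in> borel_measurable (vec_space K)"
    and "f \<in> S \<rightarrow>\<^sub>M vec_space K"
  shows "(\<lambda>(x, c). cs_surrogate K loss c (f x)) \<in> borel_measurable (S \<Otimes>\<^sub>M vec_space K)"
proof -
  have l: "(\<lambda>z. loss i (f (fst z))) \<in> borel_measurable (S \<Otimes>\<^sub>M vec_space K)" if "i \<in> {1..K+1}" for i
    using assms(1)[OF that] assms(2) by measurable
  have c: "(\<lambda>z. snd z i) \<in> borel_measurable (S \<Otimes>\<^sub>M vec_space K)" if "i \<in> {1..K+1}" for i
    using measurable_vec_component[OF that] by (rule measurable_compose[OF measurable_snd])
  show ?thesis
    unfolding case_prod_unfold cs_surrogate_def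
    using l c by (intro borel_measurable_sum borel_measurable_times borel_measurable_diff
      borel_measurable_Max) auto
qed

lemma measurable_chosen_cost:
  assumes "h \<in> S \<rightarrow>\<^sub>M count_space {1..K+1}"
  shows "(\<lambda>(x, c). c (h x)) \<in> borel_measurable (S \<Otimes>\<^sub>M vec_space K)"
  unfolding case_prod_unfold
  by (rule measurable_compose_countable'[where I = "{1..K+1}"])
     (use assms in \<open>auto intro!: measurable_compose[OF measurable_snd measurable_vec_component]\<close>)

section \<open>Integrability of costs and gaps under a cost law\<close>

locale cost_setting =
  fixes S :: "'x measure" and K :: nat and D :: "('x \<times> (nat \<Rightarrow> real)) measure"
  assumes cost_law: "cost_law S K D"
begin

sublocale prob_space D
  using cost_law by (simp add: cost_law_def)

lemma sets_D: "sets D = sets (S \<Otimes>\<^sub>M vec_space K)"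
  using cost_law by (simp add: cost_law_def)

lemma space_D: "space D = space S \<times> space (vec_space K)"
  using sets_eq_imp_space_eq[OF sets_D] by (simp add: space_pair_measure)

lemma measurable_D: "g \<in> measurable (S \<Otimes>\<^sub>M vec_space K) N \<Longrightarrow> g \<in> measurable D N"
  using measurable_cong_sets[OF sets_D refl] by blast

lemma integrable_cost: "i \<in> {1..K+1} \<Longrightarrow> integrable D (\<lambda>z. snd z i)"
  using cost_law by (auto simp: cost_law_def case_prod_unfold)

text \<open>The weight that the surrogate puts on label \<open>i\<close>, as a random variable under
  the cost law, so that it can serve as a density.\<close>

definition gap :: "nat \<Rightarrow> 'x \<times> (nat \<Rightarrow> real) \<Rightarrow> real" where
  "gap i z = Max (snd z ` {1..K+1}) - snd z i"

lemma gap_nonneg: "i \<in> {1..K+1} \<Longrightarrow> 0 \<le> gap i z"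
  by (simp add: gap_def)

lemma cs_surrogate_gap: "cs_surrogate K loss (snd z) v = (\<Sum>i\<in>{1..K+1}. gap i z * loss i v)"
  by (simp add: cs_surrogate_def gap_def)

text \<open>The maximum is attained at some coordinate, hence dominated by the sum of all absolute
  costs, which is integrable.\<close>

lemma integrable_gap:
  assumes "i \<in> {1..K+1}"
  shows "integrable D (gap i)"
proof -
  have "integrable D (\<lambda>z. Max (snd z ` {1..K+1}))"
  proof (rule Bochner_Integration.integrable_bound)
    show "integrable D (\<lambda>z. \<Sum>i\<in>{1..K+1}. \<bar>snd z i\<bar>)"
      using integrable_cost by (intro Bochner_Integration.integrable_sum integrable_abs)
    show "(\<lambda>z. Max (snd z ` {1..K+1})) \<in> borel_measurable D"
      using integrable_cost by (intro borel_measurable_Max) auto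
    show "AE z in D. norm (Max (snd z ` {1..K+1})) \<le> norm (\<Sum>i\<in>{1..K+1}. \<bar>snd z i\<bar>)"
    proof (intro AE_I2)
      fix z :: "'x \<times> (nat \<Rightarrow> real)"
      have "Max (snd z ` {1..K+1}) \<in> snd z ` {1..K+1}"
        by (intro Max_in) auto
      then obtain j where "j \<in> {1..K+1}" "Max (snd z ` {1..K+1}) = snd z j"
        by (elim imageE)
      then show "norm (Max (snd z ` {1..K+1})) \<le> norm (\<Sum>i\<in>{1..K+1}. \<bar>snd z i\<bar>)"
        using member_le_sum[of j "{1..K+1}" "\<lambda>i. \<bar>snd z i\<bar>"] by (simp add: sum_nonneg)
    qed
  qed
  then show ?thesis
    using integrable_cost[OF assms] by (simp add: gap_def[abs_def])
qed

text \<open>\<open>h\<close> picks one of the finitely many coordinates at each point, so the sum of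
  absolute costs dominates here as well.\<close>

lemma integrable_chosen_cost:
  assumes h: "h \<in> S \<rightarrow>\<^sub>M count_space {1..K+1}"
  shows "integrable D (\<lambda>z. snd z (h (fst z)))"
proof (rule Bochner_Integration.integrable_bound)
  show "integrable D (\<lambda>z. \<Sum>i\<in>{1..K+1}. \<bar>snd z i\<bar>)"
    using integrable_cost by (intro Bochner_Integration.integrable_sum integrable_abs)
  show "(\<lambda>z. snd z (h (fst z))) \<in> borel_measurable D"
    using measurable_D[OF measurable_chosen_cost[OF h]] by (simp add: case_prod_unfold)
  show "AE z in D. norm (snd z (h (fst z))) \<le> norm (\<Sum>i\<in>{1..K+1}. \<bar>snd z i\<bar>)"
  proof (intro AE_I2)
    fix z assume "z \<in> space D"
    then have "h (fst z) \<in> {1..K+1}"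
      using measurable_space[OF h] by (auto simp: space_D)
    then show "norm (snd z (h (fst z))) \<le> norm (\<Sum>i\<in>{1..K+1}. \<bar>snd z i\<bar>)"
      using member_le_sum[of "h (fst z)" "{1..K+1}" "\<lambda>i. \<bar>snd z i\<bar>"] by (simp add: sum_nonneg)
  qed
qed

section \<open>Optimality on sets of features where the losses are bounded\<close>

text \<open>
  \<open>f\<close> minimizes the multiclass risk under the label law restricted to \<open>A\<close>: a competitor \<open>g\<close> is
  turned into a competitor in the cost-sensitive problem by replacing it with \<open>f\<close> off \<open>A\<close>.
\<close>

lemma localized_cost_nonneg:
  assumes am: "argmax_rule K am"
    and loss: "\<And>i. i \<in> {1..K+1} \<Longrightarrow> loss i \<in> borel_measurable (vec_space K)"
    and cons: "multiclass_consistent S K am loss"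
    and f: "surrogate_minimizer S K D (cs_surrogate K loss) f"
    and h: "h \<in> S \<rightarrow>\<^sub>M count_space {1..K+1}"
    and A: "A \<in> sets S"
    and bound: "\<And>x i. x \<in> A \<Longrightarrow> i \<in> {1..K+1} \<Longrightarrow> \<bar>loss i (f x)\<bar> \<le> B"
  shows "0 \<le> (\<integral>z. indicator A (fst z) * (snd z (h (fst z)) - snd z (am (f (fst z)))) \<partial>D)"
proof -
  note sum.cl_ivl_Suc [simp del]
  let ?I = "{1..K+1}"
  have f_meas: "f \<in> S \<rightarrow>\<^sub>M vec_space K"
    and f_int: "integrable D (\<lambda>z. \<Sum>i\<in>?I. gap i z * loss i (f (fst z)))"
    and f_min: "\<And>g. g \<in> S \<rightarrow>\<^sub>M vec_space K \<Longrightarrow>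
      integrable D (\<lambda>z. \<Sum>i\<in>?I. gap i z * loss i (g (fst z))) \<Longrightarrow>
      (\<integral>z. (\<Sum>i\<in>?I. gap i z * loss i (f (fst z))) \<partial>D)
        \<le> (\<integral>z. (\<Sum>i\<in>?I. gap i z * loss i (g (fst z))) \<partial>D)"
    using f by (auto simp: surrogate_minimizer_def is_arg_min_linorder case_prod_unfold cs_surrogate_gap)
  have am_f: "(\<lambda>x. am (f x)) \<in> S \<rightarrow>\<^sub>M count_space ?I"
    using am f_meas by (auto simp: argmax_rule_def intro: measurable_compose)
  \<comment> \<open>Cutting the gaps off outside \<open>A\<close> confines the label law to features
    where the losses of \<open>f\<close> are bounded.\<close>
  define w where "w i z = indicator A (fst z) * gap i z" for i and z :: "'x \<times> (nat \<Rightarrow> real)"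
  have A_meas: "(\<lambda>z. indicator A (fst z) :: real) \<in> borel_measurable D"
    using A by (intro measurable_D measurable_compose[OF measurable_fst]) auto
  have w_int: "integrable D (w i)" if "i \<in> ?I" for i
    using integrable_gap[OF that] A_meas
    by (intro Bochner_Integration.integrable_bound[OF integrable_gap[OF that]])
       (auto simp: w_def[abs_def] indicator_def)
  have w_nonneg: "0 \<le> w i z" if "i \<in> ?I" for i z
    using gap_nonneg[OF that] by (simp add: w_def)
  \<comment> \<open>The maximal cost cancels in a difference of two gaps, which leaves the
    difference of the costs with its sign reversed.\<close>
  have select: "indicator A (fst z) * (snd z (h (fst z)) - snd z (am (f (fst z)))) =
      w (am (f (fst z))) z - w (h (fst z)) z" for z
    by (simp add: w_def gap_def algebra_simps)
  show ?thesis
  proof (cases "(\<Sum>i\<in>?I. integral\<^sup>L D (w i)) = 0")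
    \<comment> \<open>With zero total weight there is no label law to normalize, but then all
      weights, and with them the integrand, vanish almost everywhere.\<close>
    case True
    then have "integral\<^sup>L D (w i) = 0" if "i \<in> ?I" for i
      using that w_nonneg by (subst (asm) sum_nonneg_eq_0_iff) (auto intro: integral_nonneg)
    then have "AE z in D. w i z = 0" if "i \<in> ?I" for i
      using that w_int w_nonneg by (subst integral_nonneg_eq_0_iff_AE[symmetric]) auto
    \<comment> \<open>One null set must serve all labels, since the labels chosen by
      \<open>h\<close> and by \<open>f\<close> vary with \<open>z\<close>.\<close>
    then have "AE z in D. \<forall>i\<in>?I. w i z = 0"
      by (intro AE_finite_allI) auto
    then have "AE z in D. indicator A (fst z) * (snd z (h (fst z)) - snd z (am (f (fst z)))) = 0"
    proof (rule AE_mp, intro AE_I2 impI)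
      fix z assume "z \<in> space D" and "\<forall>i\<in>?I. w i z = 0"
      moreover from this have "h (fst z) \<in> ?I" "am (f (fst z)) \<in> ?I"
        using measurable_space[OF h] measurable_space[OF am_f] by (auto simp: space_D)
      ultimately show "indicator A (fst z) * (snd z (h (fst z)) - snd z (am (f (fst z)))) = 0"
        unfolding select by simp
    qed
    then have "(\<integral>z. indicator A (fst z) * (snd z (h (fst z)) - snd z (am (f (fst z)))) \<partial>D) = 0"
      by (rule integral_eq_zero_AE)
    then show ?thesis by simp
  next
    case False
    then have pos: "0 < (\<Sum>i\<in>?I. integral\<^sup>L D (w i))"
      using w_nonneg by (intro order.not_eq_order_implies_strict sum_nonneg integral_nonneg) auto
    obtain L where L: "prob_space L" "sets L = sets (S \<Otimes>\<^sub>M count_space ?I)"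
      and L_iff: "\<And>g. g \<in> borel_measurable (S \<Otimes>\<^sub>M count_space ?I) \<Longrightarrow>
        integrable L g \<longleftrightarrow> (\<forall>i\<in>?I. integrable D (\<lambda>z. w i z * g (fst z, i)))"
      and L_eq: "\<And>g. g \<in> borel_measurable (S \<Otimes>\<^sub>M count_space ?I) \<Longrightarrow> integrable L g \<Longrightarrow>
        integral\<^sup>L L g = (\<Sum>i\<in>?I. \<integral>z. w i z * g (fst z, i) \<partial>D) / (\<Sum>i\<in>?I. integral\<^sup>L D (w i))"
      by (rule exists_label_law[OF sigma_finite_measure_axioms sets_D finite_atLeastAtMost w_int _ pos])
        (use w_nonneg in auto)
    \<comment> \<open>The normalizing constant cancels, so two risks under \<open>L\<close> compare
      by the sign of one integral under \<open>D\<close>. This is used for the surrogate losses and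
      again for the 0-1 losses.\<close>
    have L_mono: "integral\<^sup>L L g \<le> integral\<^sup>L L g' \<longleftrightarrow>
        0 \<le> (\<integral>z. (\<Sum>i\<in>?I. w i z * (g' (fst z, i) - g (fst z, i))) \<partial>D)"
      if g: "g \<in> borel_measurable (S \<Otimes>\<^sub>M count_space ?I)" "integrable L g"
        and g': "g' \<in> borel_measurable (S \<Otimes>\<^sub>M count_space ?I)" "integrable L g'" for g g'
    proof -
      have int: "integrable D (\<lambda>z. w i z * g (fst z, i))"
        "integrable D (\<lambda>z. w i z * g' (fst z, i))" if "i \<in> ?I" for i
        using that g g' L_iff by blast+
      have "(\<integral>z. (\<Sum>i\<in>?I. w i z * (g' (fst z, i) - g (fst z, i))) \<partial>D) =
          (\<Sum>i\<in>?I. \<integral>z. w i z * (g' (fst z, i) - g (fst z, i)) \<partial>D)"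
        using int by (intro Bochner_Integration.integral_sum) (simp add: right_diff_distrib)
      also have "\<dots> =
        (\<Sum>i\<in>?I. \<integral>z. w i z * g' (fst z, i) \<partial>D) - (\<Sum>i\<in>?I. \<integral>z. w i z * g (fst z, i) \<partial>D)"
        unfolding sum_subtractf[symmetric]
        using int by (intro sum.cong) (simp_all add: right_diff_distrib)
      finally show ?thesis
        unfolding L_eq[OF g] L_eq[OF g'] using pos by (simp add: divide_le_cancel)
    qed
    have score: "(\<lambda>(x, y). loss y (g x)) \<in> borel_measurable (S \<Otimes>\<^sub>M count_space ?I)"
      if "g \<in> S \<rightarrow>\<^sub>M vec_space K" for g
      using loss that by (rule measurable_score)
    have "surrogate_minimizer S K L loss f"
      unfolding surrogate_minimizer_def is_arg_min_linorder
    proof (intro conjI allI impI; (elim conjE)?)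
      show "f \<in> S \<rightarrow>\<^sub>M vec_space K" by fact
      \<comment> \<open>Here truncation pays off: the weight vanishes off \<open>A\<close>, and on
        \<open>A\<close> the bound \<open>B\<close> makes each single label's term integrable, not
        merely their sum.\<close>
      have "integrable D (\<lambda>z. w i z * loss i (f (fst z)))" if i: "i \<in> ?I" for i
      proof (rule Bochner_Integration.integrable_bound)
        show "integrable D (\<lambda>z. B * w i z)"
          using w_int[OF i] by simp
        have "(\<lambda>z. loss i (f (fst z))) \<in> borel_measurable D"
          by (intro measurable_D measurable_compose[OF measurable_compose[OF measurable_fst f_meas] loss[OF i]])
        then show "(\<lambda>z. w i z * loss i (f (fst z))) \<in> borel_measurable D"
          using w_int[OF i] by simp
        have "\<bar>w i z * loss i (f (fst z))\<bar> \<le> \<bar>B * w i z\<bar>" for z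
        proof (cases "fst z \<in> A")
          case True
          then have "\<bar>loss i (f (fst z))\<bar> \<le> \<bar>B\<bar>"
            using bound[OF _ i] by (meson abs_ge_self order_trans)
          then show ?thesis
            by (simp add: abs_mult mult_left_mono mult.commute[of "\<bar>B\<bar>"])
        qed (simp add: w_def)
        then show "AE z in D. norm (w i z * loss i (f (fst z))) \<le> norm (B * w i z)"
          by simp
      qed
      then show f_L: "integrable L (\<lambda>(x, y). loss y (f x))"
        using L_iff[OF score[OF f_meas]] by simp
      fix g assume g: "g \<in> S \<rightarrow>\<^sub>M vec_space K" and g_L: "integrable L (\<lambda>(x, y). loss y (g x))"
      define g' where "g' x = (if x \<in> A then g x else f x)" for x
      let ?d = "\<lambda>z. \<Sum>i\<in>?I. w i z * (loss i (g (fst z)) - loss i (f (fst z)))"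
      have g': "g' \<in> S \<rightarrow>\<^sub>M vec_space K"
        unfolding g'_def using g f_meas A by (intro measurable_If_set) auto
      have d_int: "integrable D ?d"
        using f_L g_L L_iff[OF score[OF f_meas]] L_iff[OF score[OF g]]
        unfolding right_diff_distrib by (intro Bochner_Integration.integrable_sum) simp
      \<comment> \<open>\<open>g'\<close> differs from \<open>f\<close> only on \<open>A\<close>,
        where \<open>w\<close> equals the gap. Its surrogate is that of \<open>f\<close> plus the
        integrable \<open>?d\<close>, so \<open>g'\<close> has finite risk even if the separate
        terms of \<open>f\<close> off \<open>A\<close> are not integrable.\<close>
      have split: "(\<Sum>i\<in>?I. gap i z * loss i (g' (fst z))) =
          (\<Sum>i\<in>?I. gap i z * loss i (f (fst z))) + ?d z" for z
        by (simp add: g'_def w_def sum.distrib[symmetric] algebra_simps)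
      have "0 \<le> integral\<^sup>L D ?d"
        using f_min[OF g'] f_int d_int unfolding split by simp
      then show "(\<integral>(x, y). loss y (f x) \<partial>L) \<le> (\<integral>(x, y). loss y (g x) \<partial>L)"
        using L_mono[OF score[OF f_meas] f_L score[OF g] g_L]
        by simp
    qed
    then have "(\<integral>(x, y). of_bool (y \<noteq> am (f x)) \<partial>L) \<le> (\<integral>(x, y). of_bool (y \<noteq> h x) \<partial>L :: real)"
      using cons L h unfolding multiclass_consistent_def is_arg_min_linorder by blast
    moreover have ind_meas: "(\<lambda>(x, y). of_bool (y \<noteq> k x) :: real) \<in> borel_measurable (S \<Otimes>\<^sub>M count_space ?I)"
      and ind_int: "integrable L (\<lambda>(x, y). of_bool (y \<noteq> k x) :: real)"
      if k: "k \<in> S \<rightarrow>\<^sub>M count_space ?I" for k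
    proof -
      show meas: "(\<lambda>(x, y). of_bool (y \<noteq> k x) :: real) \<in> borel_measurable (S \<Otimes>\<^sub>M count_space ?I)"
        unfolding case_prod_unfold
        by (rule measurable_compose_countable'[OF measurable_compose[OF measurable_compose[OF measurable_fst k]]
              measurable_snd]) auto
      interpret L: prob_space L by fact
      show "integrable L (\<lambda>(x, y). of_bool (y \<noteq> k x) :: real)"
        using meas L(2)
        by (intro L.integrable_const_bound[of _ 1]) (auto simp: measurable_cong_sets[OF L(2) refl])
    qed
    ultimately have "0 \<le> (\<integral>z. (\<Sum>i\<in>?I. w i z * (of_bool (i \<noteq> h (fst z)) - of_bool (i \<noteq> am (f (fst z))))) \<partial>D)"
      using L_mono[OF ind_meas[OF am_f] ind_int[OF am_f] ind_meas[OF h] ind_int[OF h]] by simp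
    \<comment> \<open>Summing \<open>w i\<close> over all labels other than \<open>k\<close> gives
      the total weight minus \<open>w k\<close>. The totals cancel in the difference, and
      \<open>select\<close> turns the remaining two weights into costs.\<close>
    also have "\<dots> = (\<integral>z. indicator A (fst z) * (snd z (h (fst z)) - snd z (am (f (fst z)))) \<partial>D)"
    proof (rule Bochner_Integration.integral_cong[OF refl])
      fix z assume "z \<in> space D"
      then have "h (fst z) \<in> ?I" "am (f (fst z)) \<in> ?I"
        using measurable_space[OF h] measurable_space[OF am_f] by (auto simp: space_D)
      moreover have "w i z * (of_bool (i \<noteq> h (fst z)) - of_bool (i \<noteq> am (f (fst z)))) =
          (if i = am (f (fst z)) then w i z else 0) - (if i = h (fst z) then w i z else 0)" for i
        by auto
      ultimately show "(\<Sum>i\<in>?I. w i z * (of_bool (i \<noteq> h (fst z)) - of_bool (i \<noteq> am (f (fst z))))) =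
          indicator A (fst z) * (snd z (h (fst z)) - snd z (am (f (fst z))))"
        unfolding select by (simp only: sum_subtractf sum.delta finite_atLeastAtMost if_True)
    qed
    finally show ?thesis .
  qed
qed

end

section \<open>Cost-sensitive consistency by exhausting the feature space\<close>

lemma cost_sensitive_consistent_cs_surrogate:
  assumes am: "argmax_rule K am"
    and loss: "\<And>i. i \<in> {1..K+1} \<Longrightarrow> loss i \<in> borel_measurable (vec_space K)"
    and cons: "multiclass_consistent S K am loss"
  shows "cost_sensitive_consistent S K am (cs_surrogate K loss)"
  unfolding cost_sensitive_consistent_def is_arg_min_linorder
proof (intro allI impI conjI)
  fix D f
  assume "cost_law S K D" and f: "surrogate_minimizer S K D (cs_surrogate K loss) f"
  then interpret cost_setting S K D by unfold_locales
  have f_meas: "f \<in> S \<rightarrow>\<^sub>M vec_space K"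
    using f by (simp add: surrogate_minimizer_def is_arg_min_def)
  show am_f: "(\<lambda>x. am (f x)) \<in> S \<rightarrow>\<^sub>M count_space {1..K+1}"
    using am f_meas by (auto simp: argmax_rule_def intro: measurable_compose)
  fix h assume h: "h \<in> S \<rightarrow>\<^sub>M count_space {1..K+1}"
  define A where "A n = {x \<in> space S. \<forall>i\<in>{1..K+1}. \<bar>loss i (f x)\<bar> \<le> real n}" for n
  let ?d = "\<lambda>z. snd z (h (fst z)) - snd z (am (f (fst z)))"
  have A: "A n \<in> sets S" for n
  proof -
    have "(\<lambda>x. loss i (f x)) \<in> borel_measurable S" if "i \<in> {1..K+1}" for i
      using loss[OF that] f_meas by measurable
    then show ?thesis
      unfolding A_def by (intro sets.sets_Collect_finite_All) (auto intro!: borel_measurable_le)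
  qed
  have "0 \<le> (\<integral>z. indicator (A n) (fst z) * ?d z \<partial>D)" for n
    by (rule localized_cost_nonneg[OF am loss cons f h A, where B = "real n"]) (auto simp: A_def)
  \<comment> \<open>The dominating function involves only the chosen costs, which are integrable,
    and none of the possibly non-integrable losses.\<close>
  moreover have "(\<lambda>n. \<integral>z. indicator (A n) (fst z) * ?d z \<partial>D) \<longlonglongrightarrow> integral\<^sup>L D ?d"
  proof (rule integral_dominated_convergence)
    have d: "integrable D ?d"
      using integrable_chosen_cost[OF h] integrable_chosen_cost[OF am_f] by simp
    show "integrable D (\<lambda>z. \<bar>?d z\<bar>)" "?d \<in> borel_measurable D"
      using d by auto
    have "(\<lambda>z. indicator (A n) (fst z) :: real) \<in> borel_measurable D" for n
      using A by (intro measurable_D measurable_compose[OF measurable_fst]) auto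
    then show "(\<lambda>z. indicator (A n) (fst z) * ?d z) \<in> borel_measurable D" for n
      using d by simp
    show "AE z in D. norm (indicator (A n) (fst z) * ?d z) \<le> \<bar>?d z\<bar>" for n
      by (auto simp: indicator_def)
    show "AE z in D. (\<lambda>n. indicator (A n) (fst z) * ?d z) \<longlonglongrightarrow> ?d z"
    proof (intro AE_I2 tendsto_eventually)
      fix z assume z: "z \<in> space D"
      \<comment> \<open>The sum bounds the losses of all labels at once, so from a single index
        \<open>N\<close> on the point lies in \<open>A n\<close> and the sequence is
        constant.\<close>
      obtain N where N: "(\<Sum>i\<in>{1..K+1}. \<bar>loss i (f (fst z))\<bar>) \<le> real N"
        using real_arch_simple by blast
      have "fst z \<in> A n" if "N \<le> n" for n
      proof -
        have "\<bar>loss i (f (fst z))\<bar> \<le> real n" if "i \<in> {1..K+1}" for i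
          using member_le_sum[OF that, of "\<lambda>i. \<bar>loss i (f (fst z))\<bar>"] N \<open>N \<le> n\<close> by force
        then show ?thesis
          using z by (auto simp: A_def space_D)
      qed
      then show "\<forall>\<^sub>F n in sequentially. indicator (A n) (fst z) * ?d z = ?d z"
        by (intro eventually_sequentiallyI[of N]) simp
    qed
  qed
  ultimately have "0 \<le> integral\<^sup>L D ?d"
    by (intro LIMSEQ_le_const) auto
  then show "(\<integral>(x, c). c (am (f x)) \<partial>D) \<le> (\<integral>(x, c). c (h x) \<partial>D)"
    using integrable_chosen_cost[OF h] integrable_chosen_cost[OF am_f]
    by (simp add: case_prod_unfold)
qed

section \<open>Learning to defer as a cost-sensitive problem\<close>

lemma deferral_consistent_cs_surrogate:
  assumes loss: "\<And>i. i \<in> {1..K+1} \<Longrightarrow> loss i \<in> borel_measurable (vec_space K)"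
    and cons: "cost_sensitive_consistent S K am (cs_surrogate K loss)"
  shows "deferral_consistent S K am (cs_surrogate K loss)"
  unfolding deferral_consistent_def
proof (intro allI impI)
  fix \<mu> f
  assume "prob_space \<mu>"
    and \<mu>: "sets \<mu> = sets (S \<Otimes>\<^sub>M count_space {1..K} \<Otimes>\<^sub>M count_space (UNIV :: nat set))"
    and f: "surrogate_minimizer S K \<mu> (\<lambda>(y, m). cs_surrogate K loss (deferral_cost K y m)) f"
  then interpret prob_space \<mu> by simp
  let ?I = "{1..K+1}"
  have space: "space \<mu> = space S \<times> {1..K} \<times> UNIV"
    using sets_eq_imp_space_eq[OF \<mu>] by (simp add: space_pair_measure)
  \<comment> \<open>A probability space is nonempty, so some label exists. This makes the dummy
    class \<open>1\<close> of the decoded classifier a legal label.\<close>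
  have K: "1 \<le> K"
    using not_empty by (auto simp: space)
  define t where "t p = (fst p, deferral_cost K (fst (snd p)) (snd (snd p)))" for p :: "'a \<times> nat \<times> nat"
  have x: "fst \<in> \<mu> \<rightarrow>\<^sub>M S" and y: "(\<lambda>p. fst (snd p)) \<in> \<mu> \<rightarrow>\<^sub>M count_space UNIV"
    and m: "(\<lambda>p. snd (snd p)) \<in> \<mu> \<rightarrow>\<^sub>M count_space UNIV"
    unfolding measurable_cong_sets[OF \<mu> refl]
    by (auto intro: measurable_count_space_mono[of _ _ "{1..K}"])
  \<comment> \<open>\<open>deferral_cost\<close> is extensional on the index set, as points of
    \<open>vec_space\<close> must be, so measurability of the coordinates suffices.\<close>
  have t: "t \<in> \<mu> \<rightarrow>\<^sub>M S \<Otimes>\<^sub>M vec_space K"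
  proof -
    have "(\<lambda>p. of_bool (snd (snd p) \<noteq> fst (snd p)) :: real) \<in> borel_measurable \<mu>"
      by (rule measurable_compose_countable[OF measurable_compose[OF m] y]) simp
    moreover have "(\<lambda>p. of_bool (i \<noteq> fst (snd p)) :: real) \<in> borel_measurable \<mu>" for i
      by (rule measurable_compose[OF y]) simp
    ultimately show ?thesis
      unfolding t_def vec_space_def deferral_cost_def
      by (intro measurable_Pair x measurable_restrict) simp
  qed
  define D where "D = distr \<mu> (S \<Otimes>\<^sub>M vec_space K) t"
  have D_iff: "integrable D g \<longleftrightarrow> integrable \<mu> (\<lambda>p. g (t p))"
    and D_eq: "integral\<^sup>L D g = (\<integral>p. g (t p) \<partial>\<mu>)"
    if "g \<in> borel_measurable (S \<Otimes>\<^sub>M vec_space K)" for g :: "_ \<Rightarrow> real"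
    using that t by (auto simp: D_def integrable_distr_eq integral_distr)
  have cost: "cost_law S K D"
    unfolding cost_law_def
  proof (intro conjI ballI)
    show "prob_space D"
      unfolding D_def by (rule prob_space_distr[OF t])
    show "sets D = sets (S \<Otimes>\<^sub>M vec_space K)"
      by (simp add: D_def)
    have c: "(\<lambda>(x, c). c i) \<in> borel_measurable (S \<Otimes>\<^sub>M vec_space K)" if "i \<in> ?I" for i
      unfolding case_prod_unfold using that
      by (intro measurable_compose[OF measurable_snd measurable_vec_component])
    have "AE z in D. \<forall>i\<in>?I. 0 \<le> (\<lambda>(x, c). c i) z"
    proof (intro AE_finite_allI finite_atLeastAtMost)
      fix i assume i: "i \<in> ?I"
      show "AE z in D. 0 \<le> (\<lambda>(x, c). c i) z"
        unfolding D_def using c[OF i] i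
        by (subst AE_distr_iff[OF t]) (auto simp: t_def deferral_cost_def case_prod_unfold)
    qed
    then show "AE (x, c) in D. \<forall>i\<in>?I. 0 \<le> c i"
      by (simp add: case_prod_unfold)
    fix i assume i: "i \<in> ?I"
    show "integrable D (\<lambda>(x, c). c i)"
      unfolding D_iff[OF c[OF i]] using measurable_compose[OF t c[OF i]] i
      by (intro integrable_const_bound[of _ 1]) (auto simp: t_def deferral_cost_def)
  qed
  \<comment> \<open>Passing to the image law changes neither the integrability nor the value of the
    surrogate risk of any measurable score, so admissible scores and minimizers are the same for
    both laws.\<close>
  have "surrogate_minimizer S K D (cs_surrogate K loss) f"
  proof -
    have "integrable D (\<lambda>(x, c). cs_surrogate K loss c (g x)) \<longleftrightarrow>
        integrable \<mu> (\<lambda>(x, a). (case a of (y, m) \<Rightarrow> cs_surrogate K loss (deferral_cost K y m)) (g x))"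
      "(\<integral>(x, c). cs_surrogate K loss c (g x) \<partial>D) =
        (\<integral>(x, a). (case a of (y, m) \<Rightarrow> cs_surrogate K loss (deferral_cost K y m)) (g x) \<partial>\<mu>)"
      if "g \<in> S \<rightarrow>\<^sub>M vec_space K" for g
      using D_iff[OF measurable_cs_surrogate[OF loss that]] D_eq[OF measurable_cs_surrogate[OF loss that]]
      by (simp_all add: t_def case_prod_unfold)
    then show ?thesis
      using f unfolding surrogate_minimizer_def is_arg_min_linorder by metis
  qed
  then have am_f: "(\<lambda>x. am (f x)) \<in> S \<rightarrow>\<^sub>M count_space ?I"
    and min: "\<And>h. h \<in> S \<rightarrow>\<^sub>M count_space ?I \<Longrightarrow>
      (\<integral>(x, c). c (am (f x)) \<partial>D) \<le> (\<integral>(x, c). c (h x) \<partial>D)"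
    using cons cost by (auto simp: cost_sensitive_consistent_def is_arg_min_linorder)
  \<comment> \<open>\<open>hr\<close> says that \<open>k\<close> encodes the pair with deferral as
    class \<open>K + 1\<close>. It leaves \<open>h\<close> free where \<open>r\<close> defers, which
    covers both the dummy class of the decoded pair and an arbitrary competitor.\<close>
  have loss_eq: "(\<integral>(x, c). c (k x) \<partial>D) = deferral_loss \<mu> h r"
    if k: "k \<in> S \<rightarrow>\<^sub>M count_space ?I"
      and hr: "\<And>x. x \<in> space S \<Longrightarrow> k x = K + 1 \<and> r x = 1 \<or> k x \<in> {1..K} \<and> h x = k x \<and> r x = 0"
    for k h r
    unfolding D_eq[OF measurable_chosen_cost[OF k]] deferral_loss_def
  proof (rule Bochner_Integration.integral_cong[OF refl])
    fix p assume "p \<in> space \<mu>"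
    then have "fst p \<in> space S" by (auto simp: space)
    from hr[OF this] show "(\<lambda>(x, c). c (k x)) (t p) = (\<lambda>(x, y, m). of_bool (h x \<noteq> y) * of_bool (r x = 0) +
                  of_bool (m \<noteq> y) * of_bool (r x = 1)) p"
      by (auto simp: t_def deferral_cost_def case_prod_unfold)
  qed
  let ?h = "\<lambda>x. decode_classifier K (am (f x))" and ?r = "\<lambda>x. decode_rejector K (am (f x))"
  have h: "?h \<in> S \<rightarrow>\<^sub>M count_space {1..K}" and r: "?r \<in> S \<rightarrow>\<^sub>M count_space {0, 1}"
    using K by (auto intro!: measurable_compose[OF am_f] simp: decode_classifier_def decode_rejector_def)
  have opt: "deferral_loss \<mu> ?h ?r \<le> deferral_loss \<mu> h r"
    if h: "h \<in> S \<rightarrow>\<^sub>M count_space {1..K}" and r: "r \<in> S \<rightarrow>\<^sub>M count_space {0, 1}" for h r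
  proof -
    \<comment> \<open>Encoding a competing pair as one classifier forgets \<open>h\<close> on the
      deferred features, where the deferral loss does not see it.\<close>
    define k where "k x = (if r x = 1 then K + 1 else h x)" for x
    have k: "k \<in> S \<rightarrow>\<^sub>M count_space ?I"
    proof -
      have "h \<in> S \<rightarrow>\<^sub>M count_space ?I"
        using h by (rule measurable_count_space_mono) auto
      moreover have "r \<in> S \<rightarrow>\<^sub>M count_space UNIV"
        using r by (rule measurable_count_space_mono) auto
      ultimately show ?thesis
        unfolding k_def by (intro measurable_If) auto
    qed
    have "(\<integral>(x, c). c (am (f x)) \<partial>D) = deferral_loss \<mu> ?h ?r"
    proof (intro loss_eq am_f)
      fix x assume "x \<in> space S"
      then have "am (f x) \<in> ?I"
        using measurable_space[OF am_f] by auto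
      then show "am (f x) = K + 1 \<and> ?r x = 1 \<or> am (f x) \<in> {1..K} \<and> ?h x = am (f x) \<and> ?r x = 0"
        by (cases "am (f x) = K + 1") (auto simp: decode_classifier_def decode_rejector_def)
    qed
    moreover have "(\<integral>(x, c). c (k x) \<partial>D) = deferral_loss \<mu> h r"
      using measurable_space[OF h] measurable_space[OF r] by (intro loss_eq k) (force simp: k_def)
    ultimately show ?thesis
      using min[OF k] by simp
  qed
  show "is_arg_min (\<lambda>(h, r). deferral_loss \<mu> h r)
      (\<lambda>(h, r). h \<in> S \<rightarrow>\<^sub>M count_space {1..K} \<and> r \<in> S \<rightarrow>\<^sub>M count_space {0, 1}) (?h, ?r)"
    using h r opt by (auto simp: is_arg_min_linorder)
qed

theorem proposition2:
  fixes S :: "'x measure" and K :: nat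
    and am :: "(nat \<Rightarrow> real) \<Rightarrow> nat"
    and loss :: "nat \<Rightarrow> (nat \<Rightarrow> real) \<Rightarrow> real"
  assumes "argmax_rule K am"
    and "\<And>i. i \<in> {1..K+1} \<Longrightarrow> loss i \<in> borel_measurable (vec_space K)"
    and "multiclass_consistent S K am loss"
  shows "cost_sensitive_consistent S K am (cs_surrogate K loss)
    \<and> deferral_consistent S K am (cs_surrogate K loss)"
  using cost_sensitive_consistent_cs_surrogate[OF assms]
    deferral_consistent_cs_surrogate[of K loss S am] assms by blast

end
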